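(* For all integers $s,k,n$ (with $n\ge1$), if $\mathsf{D}_{\oplus}(\mathrm{THR}_n^k)\ge s$, then $\mathsf{D}_{\oplus}(\mathrm{THR}_{n+2}^{k+1})\ge s+1$.
   Context: For integers $n\ge1$ and $k$, $\mathrm{THR}_n^k\colon\{0,1\}^n\to\{-1,1\}$ is defined by $\mathrm{THR}_n^k(x)=-1$ iff $\sum_{i=1}^n x_i\ge k$ (and $1$ otherwise). A parity decision tree is a rooted binary tree whose internal nodes are labeled by parities $\bigoplus_{i\in S}x_i$ ($S\subseteq[n]$), with two outgoing edges labeled by the possible parity values, and leaves labeled by $-1$ or $1$; on input $x$ one follows the edges consistent with $x$ and outputs the leaf label. $\mathsf{D}_{\oplus}(f)$ is the minimal depth of a parity decision tree computing $f$.
   Formalization: For s = 0 the condition 0 ≤ k ≤ n+1 is added: otherwise THR_{n+2}^{k+1} is constant with depth 0 and the claim fails (e.g. s = 0, k = −1); all cases with s ≠ 0 are covered unchanged. *)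

theory Defs
  imports Complex_Main "HOL-Library.FuncSet"
begin

definition cube :: "nat \<Rightarrow> (nat \<Rightarrow> nat) set" where
  "cube n = {1..n} \<rightarrow>\<^sub>E {0, 1}"

definition THR :: "nat \<Rightarrow> int \<Rightarrow> (nat \<Rightarrow> nat) \<Rightarrow> int" where
  "THR n k x = (if int (\<Sum>i = 1..n. x i) \<ge> k then -1 else 1)"

definition parity :: "nat set \<Rightarrow> (nat \<Rightarrow> nat) \<Rightarrow> nat" where
  "parity S x = (\<Sum>i\<in>S. x i) mod 2"

(* The first child of a query is taken on parity value 0, the second on value 1. *)
datatype pdt = Leaf int | Query "nat set" pdt pdt

primrec pdt_wf :: "nat \<Rightarrow> pdt \<Rightarrow> bool" where
  "pdt_wf n (Leaf b) \<longleftrightarrow> b \<in> {-1, 1}"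
| "pdt_wf n (Query S t0 t1) \<longleftrightarrow> S \<subseteq> {1..n} \<and> pdt_wf n t0 \<and> pdt_wf n t1"

primrec pdt_output :: "pdt \<Rightarrow> (nat \<Rightarrow> nat) \<Rightarrow> int" where
  "pdt_output (Leaf b) x = b"
| "pdt_output (Query S t0 t1) x =
     (if parity S x = 0 then pdt_output t0 x else pdt_output t1 x)"

primrec pdt_depth :: "pdt \<Rightarrow> nat" where
  "pdt_depth (Leaf b) = 0"
| "pdt_depth (Query S t0 t1) = Suc (max (pdt_depth t0) (pdt_depth t1))"

definition pdt_computes :: "nat \<Rightarrow> pdt \<Rightarrow> ((nat \<Rightarrow> nat) \<Rightarrow> int) \<Rightarrow> bool" where
  "pdt_computes n t f \<longleftrightarrow> pdt_wf n t \<and> (\<forall>x\<in>cube n. pdt_output t x = f x)"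

(* Only the values of f on cube n matter. The minimum exists whenever f maps cube n
   into {-1, 1}: see pdt_computes_exists. *)
definition D_xor :: "nat \<Rightarrow> ((nat \<Rightarrow> nat) \<Rightarrow> int) \<Rightarrow> nat" where
  "D_xor n f = (LEAST d. \<exists>t. pdt_computes n t f \<and> pdt_depth t = d)"

lemma pdt_computes_exists:
  assumes f: "f \<in> cube n \<rightarrow> {-1, 1}"
  shows "\<exists>t. pdt_computes n t f"
proof -
  have "\<exists>t. pdt_wf n t \<and> (\<forall>x\<in>cube n. (\<forall>i. m < i \<longrightarrow> x i = a i) \<longrightarrow> pdt_output t x = f x)"
    if "m \<le> n" for m and a :: "nat \<Rightarrow> nat"
    using that
  proof (induction m arbitrary: a)
    case 0
    show ?case
    proof (cases "\<exists>y\<in>cube n. \<forall>i>0. y i = a i")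
      case True
      then obtain y where y: "y \<in> cube n" "\<forall>i>0. y i = a i" by blast
      have "x = y" if "x \<in> cube n" "\<forall>i>0. x i = a i" for x
      proof
        fix i
        show "x i = y i"
          using that y by (cases "i = 0") (auto simp: cube_def PiE_def extensional_def)
      qed
      moreover have "f y \<in> {-1, 1}" using f y(1) by blast
      ultimately show ?thesis by (intro exI[of _ "Leaf (f y)"]) auto
    next
      case False
      then show ?thesis by (intro exI[of _ "Leaf 1"]) auto
    qed
  next
    case (Suc m)
    have "\<exists>t. pdt_wf n t \<and> (\<forall>x\<in>cube n. (\<forall>i. m < i \<longrightarrow> x i = (a(Suc m := b)) i) \<longrightarrow> pdt_output t x = f x)"
      for b using Suc by (meson Suc_leD)
    then obtain T where T: "\<And>b. pdt_wf n (T b)"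
      "\<And>b x. x \<in> cube n \<Longrightarrow> \<forall>i. m < i \<longrightarrow> x i = (a(Suc m := b)) i \<Longrightarrow> pdt_output (T b) x = f x"
      by metis
    have "pdt_output (Query {Suc m} (T 0) (T 1)) x = f x"
      if x: "x \<in> cube n" "\<forall>i. Suc m < i \<longrightarrow> x i = a i" for x
    proof -
      have "x (Suc m) \<in> {0, 1}" using x(1) Suc.prems by (auto simp: cube_def PiE_def Pi_def)
      moreover have "pdt_output (T (x (Suc m))) x = f x"
        using x by (intro T(2)) (auto simp: Suc_lessI)
      ultimately show ?thesis by (auto simp: parity_def)
    qed
    then show ?case using T(1) Suc.prems by (intro exI[of _ "Query {Suc m} (T 0) (T 1)"]) auto
  qed
  from this[of n "\<lambda>_. undefined"] obtain t where
    "pdt_wf n t" "\<forall>x\<in>cube n. (\<forall>i. n < i \<longrightarrow> x i = undefined) \<longrightarrow> pdt_output t x = f x" by auto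
  then show ?thesis
    unfolding pdt_computes_def
    by (intro exI[of _ t]) (auto simp: cube_def PiE_def extensional_def)
qed

end

theory Submission
  imports Defs
begin

text \<open>
  Let an optimal tree for \<open>THR\<close> on \<open>n + 2\<close> variables with threshold \<open>k + 1\<close> start with the query
  \<open>S\<close>. It suffices to restrict the input to an affine subspace of dimension \<open>n\<close> on which the
  parity of \<open>S\<close> is constant and the function becomes \<open>THR\<close> on \<open>n\<close> variables with threshold \<open>k\<close>:
  on such a subspace the root query can be dropped, and all other queries remain parities (up to
  negation) of the free variables. If some \<open>j \<notin> S\<close>, pick \<open>i \<in> S\<close> (any \<open>i \<noteq> j\<close> if \<open>S\<close> is empty), let
  \<open>x\<^sub>i\<close> be the parity of the other variables in \<open>S\<close> and let \<open>x\<^sub>j = 1 - x\<^sub>i\<close>; the pair \<open>i, j\<close> always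
  contributes exactly 1 to the sum. If \<open>S\<close> contains all variables, set one variable to 0 and
  another one such that the whole sum has the parity of \<open>k + 1\<close>: rounding the sum of the free
  variables up to this parity reaches \<open>k + 1\<close> iff the sum itself reaches \<open>k\<close>.
\<close>

section \<open>Affine forms over the two-element field and their substitution into trees\<close>

text \<open>Only residues mod 2 are constrained, so sums can be taken in \<open>nat\<close>. Since
  \<open>x\<close> ranges over all functions, no membership in \<open>cube n\<close> has to be
  carried along.\<close>

definition affine2 :: "nat \<Rightarrow> ((nat \<Rightarrow> nat) \<Rightarrow> nat) \<Rightarrow> bool" where
  "affine2 n g \<longleftrightarrow> (\<exists>S c. S \<subseteq> {1..n} \<and> (\<forall>x. g x mod 2 = (c + (\<Sum>i\<in>S. x i)) mod 2))"

lemma affine2_const: "affine2 n (\<lambda>x. c)"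
  unfolding affine2_def by (intro exI[of _ "{}"] exI[of _ c]) auto

lemma affine2_coord: "i \<in> {1..n} \<Longrightarrow> affine2 n (\<lambda>x. x i)"
  unfolding affine2_def by (intro exI[of _ "{i}"] exI[of _ 0]) auto

lemma affine2_cong:
  assumes "affine2 n g" "\<And>x. h x mod 2 = g x mod 2"
  shows "affine2 n h"
  using assms unfolding affine2_def by simp

text \<open>The index sets combine by symmetric difference: their intersection is counted twice and
  vanishes mod 2.\<close>

lemma affine2_add:
  assumes "affine2 n g" "affine2 n h"
  shows "affine2 n (\<lambda>x. g x + h x)"
proof -
  obtain S c where S: "S \<subseteq> {1..n}" "\<And>x. g x mod 2 = (c + (\<Sum>i\<in>S. x i)) mod 2"
    using assms(1) unfolding affine2_def by blast
  obtain T d where T: "T \<subseteq> {1..n}" "\<And>x. h x mod 2 = (d + (\<Sum>i\<in>T. x i)) mod 2"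
    using assms(2) unfolding affine2_def by blast
  let ?U = "(S - T) \<union> (T - S)"
  have fin: "finite S" "finite T" using S(1) T(1) finite_subset by auto
  have "(g x + h x) mod 2 = (c + d + (\<Sum>i\<in>?U. x i)) mod 2" for x
  proof -
    have "sum x S = sum x (S - T) + sum x (S \<inter> T)"
      using fin by (metis add.commute sum.Int_Diff)
    moreover have "sum x T = sum x (T - S) + sum x (S \<inter> T)"
      using fin by (metis add.commute sum.Int_Diff Int_commute)
    moreover have "sum x ?U = sum x (S - T) + sum x (T - S)"
      using fin by (intro sum.union_disjoint) auto
    ultimately have "c + sum x S + (d + sum x T) = c + d + sum x ?U + 2 * sum x (S \<inter> T)"
      by linarith
    moreover have "(g x + h x) mod 2 = (c + sum x S + (d + sum x T)) mod 2"
      using S(2)[of x] T(2)[of x] by (rule mod_add_cong)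
    ultimately show ?thesis by (simp only: mod_mult_self2)
  qed
  then show ?thesis
    unfolding affine2_def using S(1) T(1) by (intro exI[of _ ?U] exI[of _ "c + d"]) auto
qed

lemma affine2_sum:
  assumes "\<And>l. l \<in> S \<Longrightarrow> affine2 n (\<lambda>x. g l x)"
  shows "affine2 n (\<lambda>x. \<Sum>l\<in>S. g l x)"
proof (cases "finite S")
  case True
  then show ?thesis
    using assms by (induction S) (auto intro!: affine2_const affine2_add)
qed (simp add: affine2_const)

text \<open>A parity of affine forms is again affine, so each query pulls back to a single query. An
  odd constant term negates its answer, which swapping the two subtrees absorbs at no cost in
  depth.\<close>

lemma pdt_affine_substitution:
  assumes aff: "\<And>l. l \<in> {1..m} \<Longrightarrow> affine2 n (\<lambda>x. \<phi> x l)" and "pdt_wf m t"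
  shows "\<exists>t'. pdt_wf n t' \<and> pdt_depth t' = pdt_depth t \<and> (\<forall>x. pdt_output t' x = pdt_output t (\<phi> x))"
  using assms(2)
proof (induction t)
  case (Leaf b)
  then show ?case by (intro exI[of _ "Leaf b"]) auto
next
  case (Query S t0 t1)
  obtain u0 where u0: "pdt_wf n u0" "pdt_depth u0 = pdt_depth t0"
    "\<And>x. pdt_output u0 x = pdt_output t0 (\<phi> x)" using Query by auto
  obtain u1 where u1: "pdt_wf n u1" "pdt_depth u1 = pdt_depth t1"
    "\<And>x. pdt_output u1 x = pdt_output t1 (\<phi> x)" using Query by auto
  have "affine2 n (\<lambda>x. \<Sum>l\<in>S. \<phi> x l)"
    using aff Query.prems by (intro affine2_sum) auto
  then obtain U c where U: "U \<subseteq> {1..n}"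
    "\<And>x. (\<Sum>l\<in>S. \<phi> x l) mod 2 = (c + (\<Sum>i\<in>U. x i)) mod 2"
    unfolding affine2_def by blast
  show ?case
  proof (cases "even c")
    case True
    then have "parity S (\<phi> x) = parity U x" for x
      unfolding parity_def U(2) by presburger
    then show ?thesis
      using u0 u1 U(1) by (intro exI[of _ "Query U u0 u1"]) auto
  next
    case False
    then have "parity S (\<phi> x) = 0 \<longleftrightarrow> parity U x \<noteq> 0" for x
      unfolding parity_def U(2) by presburger
    then show ?thesis
      using u0 u1 U(1) by (intro exI[of _ "Query U u1 u0"]) auto
  qed
qed

section \<open>Substitutions that make the root query constant\<close>

lemma THR_substitution_missing:
  assumes S: "S \<subseteq> {1..n + 2}" and ij: "i \<in> {1..n + 2}" "j \<in> {1..n + 2}" "i \<noteq> j"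
    and "j \<notin> S" "i \<in> S \<or> S = {}"
  shows "\<exists>\<phi> b. (\<forall>l\<in>{1..n + 2}. affine2 n (\<lambda>x. \<phi> x l)) \<and>
    (\<forall>x\<in>cube n. \<phi> x \<in> cube (n + 2) \<and> THR (n + 2) (k + 1) (\<phi> x) = THR n k x \<and> parity S (\<phi> x) = b)"
proof -
  let ?R = "{1..n + 2} - {i, j}"
  \<comment> \<open>The bijection \<open>\<sigma>\<close> renumbers the coordinates other than
    \<open>i\<close> and \<open>j\<close> as the \<open>n\<close> free variables.\<close>
  have "card ?R = card {1..n}" using ij by (simp add: card_Diff_subset)
  then obtain \<sigma> where \<sigma>: "bij_betw \<sigma> ?R {1..n}"
    by (metis finite_same_card_bij finite_Diff finite_atLeastAtMost)
  have \<sigma>_in: "\<sigma> l \<in> {1..n}" if "l \<in> ?R" for l using \<sigma> that by (rule bij_betwE[rule_format])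
  define p where "p x = (\<Sum>l\<in>S - {i}. x (\<sigma> l)) mod 2" for x :: "nat \<Rightarrow> nat"
  define \<phi> where "\<phi> x = (\<lambda>l\<in>{1..n + 2}. if l = i then p x else if l = j then 1 - p x else x (\<sigma> l))"
    for x
  have Sub: "S - {i} \<subseteq> ?R" using S \<open>j \<notin> S\<close> by auto
  have affp: "affine2 n p"
    by (rule affine2_cong[OF affine2_sum[of "S - {i}" n "\<lambda>l x. x (\<sigma> l)"]])
      (use Sub in \<open>auto simp: p_def intro!: affine2_coord \<sigma>_in\<close>)
  have aff: "affine2 n (\<lambda>x. \<phi> x l)" if l: "l \<in> {1..n + 2}" for l
  proof -
    consider "l = i" | "l = j" | "l \<in> ?R" using l by blast
    then show ?thesis
    proof cases
      case 1
      then show ?thesis using l affp by (simp add: \<phi>_def)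
    next
      case 2
      \<comment> \<open>Subtraction in \<open>nat\<close> does not truncate here because
        \<open>p x\<close> is 0 or 1.\<close>
      have "(1 - p x) mod 2 = (1 + p x) mod 2" for x by (cases "p x = 0") (auto simp: p_def)
      then have "affine2 n (\<lambda>x. 1 - p x)"
        by (rule affine2_cong[OF affine2_add[OF affine2_const[of n 1] affp]])
      then show ?thesis using 2 l ij by (simp add: \<phi>_def)
    next
      case 3
      then show ?thesis using affine2_coord[OF \<sigma>_in[OF 3]] l by (simp add: \<phi>_def)
    qed
  qed
  have "\<phi> x \<in> cube (n + 2) \<and> THR (n + 2) (k + 1) (\<phi> x) = THR n k x \<and> parity S (\<phi> x) = 0"
    if x: "x \<in> cube n" for x
  proof (intro conjI)
    have p: "p x \<in> {0, 1}" by (auto simp: p_def)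
    have "x (\<sigma> l) \<in> {0, 1}" if "l \<in> ?R" for l
      using \<sigma>_in[OF that] x unfolding cube_def by (rule PiE_mem[rotated])
    then show "\<phi> x \<in> cube (n + 2)"
      using p unfolding cube_def \<phi>_def by (auto simp: PiE_iff)
    have "(\<Sum>l = 1..n + 2. \<phi> x l) = \<phi> x i + (\<phi> x j + (\<Sum>l\<in>?R. \<phi> x l))"
    proof -
      have "(\<Sum>l = 1..n + 2. \<phi> x l) = \<phi> x i + sum (\<phi> x) ({1..n + 2} - {i})"
        using ij by (intro sum.remove) auto
      also have "sum (\<phi> x) ({1..n + 2} - {i}) = \<phi> x j + sum (\<phi> x) ({1..n + 2} - {i} - {j})"
        using ij by (intro sum.remove) auto
      also have "{1..n + 2} - {i} - {j} = ?R" by auto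
      finally show ?thesis .
    qed
    moreover have "(\<Sum>l\<in>?R. \<phi> x l) = (\<Sum>l\<in>?R. x (\<sigma> l))"
      by (intro sum.cong) (auto simp: \<phi>_def)
    moreover have "(\<Sum>l\<in>?R. x (\<sigma> l)) = (\<Sum>l = 1..n. x l)"
      by (rule sum.reindex_bij_betw[OF \<sigma>])
    moreover have "\<phi> x i + \<phi> x j = 1" using p ij by (auto simp: \<phi>_def)
    ultimately have "(\<Sum>l = 1..n + 2. \<phi> x l) = Suc (\<Sum>l = 1..n. x l)" by linarith
    then show "THR (n + 2) (k + 1) (\<phi> x) = THR n k x"
      by (simp only: THR_def) simp
    show "parity S (\<phi> x) = 0"
    proof (cases "S = {}")
      case True
      then show ?thesis by (simp add: parity_def)
    next
      case False
      then have i: "i \<in> S" using assms(6) by blast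
      have "sum (\<phi> x) S = \<phi> x i + sum (\<phi> x) (S - {i})"
        using i S finite_subset by (intro sum.remove) auto
      moreover have "sum (\<phi> x) (S - {i}) = (\<Sum>l\<in>S - {i}. x (\<sigma> l))"
        using Sub by (intro sum.cong) (auto simp: \<phi>_def)
      moreover have "\<phi> x i = (\<Sum>l\<in>S - {i}. x (\<sigma> l)) mod 2"
        using ij by (simp add: \<phi>_def p_def)
      ultimately have "parity S (\<phi> x) = (2 * (\<Sum>l\<in>S - {i}. x (\<sigma> l))) mod 2"
        by (simp only: parity_def mult_2 mod_add_left_eq)
      then show ?thesis by simp
    qed
  qed
  then show ?thesis using aff by blast
qed

lemma THR_substitution_full:
  "\<exists>\<phi> b. (\<forall>l\<in>{1..n + 2}. affine2 n (\<lambda>x. \<phi> x l)) \<and>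
    (\<forall>x\<in>cube n. \<phi> x \<in> cube (n + 2) \<and> THR (n + 2) (k + 1) (\<phi> x) = THR n k x \<and>
      parity {1..n + 2} (\<phi> x) = b)"
proof -
  \<comment> \<open>The integer residue is nonnegative even for negative \<open>k\<close>, so
    \<open>nat\<close> loses nothing.\<close>
  define r where "r = nat ((k + 1) mod 2)"
  define q where "q x = (r + (\<Sum>l = 1..n. x l)) mod 2" for x :: "nat \<Rightarrow> nat"
  define \<phi> where "\<phi> x = (\<lambda>l\<in>{1..n + 2}. if l = n + 2 then q x else if l = n + 1 then 0 else x l)" for x
  have affq: "affine2 n q"
    by (rule affine2_cong[OF affine2_add[OF affine2_const[of n r]
          affine2_sum[of "{1..n}" n "\<lambda>l x. x l"]]])
      (auto simp: q_def intro!: affine2_coord)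
  have aff: "affine2 n (\<lambda>x. \<phi> x l)" if l: "l \<in> {1..n + 2}" for l
  proof -
    consider "l = n + 2" | "l = n + 1" | "l \<in> {1..n}" using l by force
    then show ?thesis
      by cases (auto simp: \<phi>_def affq affine2_const intro!: affine2_coord)
  qed
  have "\<phi> x \<in> cube (n + 2) \<and> THR (n + 2) (k + 1) (\<phi> x) = THR n k x \<and> parity {1..n + 2} (\<phi> x) = r"
    if x: "x \<in> cube n" for x
  proof (intro conjI)
    have q: "q x \<in> {0, 1}" by (auto simp: q_def)
    have "x l \<in> {0, 1}" if "l \<in> {1..n}" for l
      using that x unfolding cube_def by (rule PiE_mem[rotated])
    then show "\<phi> x \<in> cube (n + 2)"
      using q unfolding cube_def \<phi>_def by (auto simp: PiE_iff)
    have "(\<Sum>l = 1..n + 2. \<phi> x l) = (\<Sum>l = 1..n. \<phi> x l) + \<phi> x (n + 1) + \<phi> x (n + 2)"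
      by simp
    moreover have "(\<Sum>l = 1..n. \<phi> x l) = (\<Sum>l = 1..n. x l)"
      by (intro sum.cong) (auto simp: \<phi>_def)
    moreover have "\<phi> x (n + 1) = 0" "\<phi> x (n + 2) = q x" by (auto simp: \<phi>_def)
    ultimately have sum: "(\<Sum>l = 1..n + 2. \<phi> x l) = (\<Sum>l = 1..n. x l) + q x" by presburger
    have "int (q x) = (k + 1 + int (\<Sum>l = 1..n. x l)) mod 2"
      by (simp add: q_def r_def zmod_int mod_simps)
    \<comment> \<open>The critical sums are \<open>k\<close>, whose parity differs from that of
      \<open>k + 1\<close> and which is raised to \<open>k + 1\<close>, and \<open>k - 1\<close>,
      which already has the right parity and stays.\<close>
    then have "int ((\<Sum>l = 1..n. x l) + q x) \<ge> k + 1 \<longleftrightarrow> int (\<Sum>l = 1..n. x l) \<ge> k"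
      by presburger
    then show "THR (n + 2) (k + 1) (\<phi> x) = THR n k x"
      unfolding THR_def sum by presburger
    have "r < 2" unfolding r_def by linarith
    then show "parity {1..n + 2} (\<phi> x) = r"
      unfolding parity_def sum q_def by presburger
  qed
  then show ?thesis using aff by blast
qed

lemma THR_substitution:
  assumes S: "S \<subseteq> {1..n + 2}"
  obtains \<phi> b where "\<And>l. l \<in> {1..n + 2} \<Longrightarrow> affine2 n (\<lambda>x. \<phi> x l)"
    "\<And>x. x \<in> cube n \<Longrightarrow> \<phi> x \<in> cube (n + 2)"
    "\<And>x. x \<in> cube n \<Longrightarrow> THR (n + 2) (k + 1) (\<phi> x) = THR n k x"
    "\<And>x. x \<in> cube n \<Longrightarrow> parity S (\<phi> x) = b"
proof (cases "S = {1..n + 2}")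
  case True
  then show ?thesis using THR_substitution_full[of n k] that by blast
next
  case False
  then obtain j where j: "j \<in> {1..n + 2}" "j \<notin> S" using S by blast
  obtain i where "i \<in> {1..n + 2}" "i \<noteq> j" "i \<in> S \<or> S = {}"
  proof (cases "S = {}")
    case True
    show ?thesis using True that[of "if j = 1 then 2 else 1"] by auto
  next
    case False
    then show ?thesis using that j S by blast
  qed
  then show ?thesis
    using THR_substitution_missing[OF S, of i j k] j that by blast
qed

section \<open>Depth bounds and the conclusion\<close>

lemma D_xor_le: "pdt_computes n t f \<Longrightarrow> D_xor n f \<le> pdt_depth t"
  unfolding D_xor_def by (rule Least_le) blast

lemma D_xor_attained:
  assumes "f \<in> cube n \<rightarrow> {-1, 1}"
  obtains t where "pdt_computes n t f" "pdt_depth t = D_xor n f"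
proof -
  have "\<exists>d t. pdt_computes n t f \<and> pdt_depth t = d"
    using pdt_computes_exists[OF assms] by blast
  from LeastI_ex[OF this] show ?thesis using that unfolding D_xor_def by blast
qed

lemma THR_pdt_strip_root:
  assumes "pdt_computes (n + 2) (Query S t0 t1) (THR (n + 2) (k + 1))"
  shows "D_xor n (THR n k) \<le> max (pdt_depth t0) (pdt_depth t1)"
proof -
  have wf: "S \<subseteq> {1..n + 2}" "pdt_wf (n + 2) t0" "pdt_wf (n + 2) t1"
    and out: "\<And>y. y \<in> cube (n + 2) \<Longrightarrow>
      pdt_output (Query S t0 t1) y = THR (n + 2) (k + 1) y"
    using assms by (auto simp: pdt_computes_def)
  obtain \<phi> b where \<phi>: "\<And>l. l \<in> {1..n + 2} \<Longrightarrow> affine2 n (\<lambda>x. \<phi> x l)"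
    "\<And>x. x \<in> cube n \<Longrightarrow> \<phi> x \<in> cube (n + 2)"
    "\<And>x. x \<in> cube n \<Longrightarrow> THR (n + 2) (k + 1) (\<phi> x) = THR n k x"
    "\<And>x. x \<in> cube n \<Longrightarrow> parity S (\<phi> x) = b"
    using THR_substitution[OF wf(1)] by metis
  \<comment> \<open>On the image of \<open>\<phi>\<close> the root always answers \<open>b\<close>,
    so this subtree alone computes the function there.\<close>
  define t where "t = (if b = 0 then t0 else t1)"
  have "pdt_wf (n + 2) t" using wf by (simp add: t_def)
  from pdt_affine_substitution[where \<phi> = \<phi>, OF \<phi>(1) this] obtain t' where
    t': "pdt_wf n t'" "pdt_depth t' = pdt_depth t" "\<And>x. pdt_output t' x = pdt_output t (\<phi> x)"
    by blast
  have "pdt_output t' x = THR n k x" if "x \<in> cube n" for x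
    using out[OF \<phi>(2)[OF that]] \<phi>(3,4)[OF that] t'(3)[of x] by (simp add: t_def split: if_splits)
  then have "D_xor n (THR n k) \<le> pdt_depth t"
    using D_xor_le[of n t'] t'(1,2) by (simp add: pdt_computes_def)
  then show ?thesis by (auto simp: t_def split: if_splits)
qed

text \<open>Treats trees that are a single leaf: for \<open>k\<close> from 1 to \<open>n\<close> the
  all-zero and all-one inputs get different values.\<close>

lemma THR_const_threshold:
  assumes "\<And>x. x \<in> cube n \<Longrightarrow> THR n k x = b"
  shows "k \<le> 0 \<or> k > int n"
proof (rule ccontr)
  assume "\<not> (k \<le> 0 \<or> k > int n)"
  then have "THR n k (\<lambda>i\<in>{1..n}. 0) \<noteq> THR n k (\<lambda>i\<in>{1..n}. 1)"
    by (simp add: THR_def)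
  moreover have "(\<lambda>i\<in>{1..n}. 0) \<in> cube n" "(\<lambda>i\<in>{1..n}. 1) \<in> cube n"
    by (auto simp: cube_def)
  ultimately show False using assms by metis
qed

lemma D_xor_THR_const:
  assumes "k \<le> 0 \<or> k > int n"
  shows "D_xor n (THR n k) = 0"
proof -
  have le: "(\<Sum>i = 1..n. x i) \<le> n" if "x \<in> cube n" for x
  proof -
    have "x i \<le> 1" if "i \<in> {1..n}" for i
      using PiE_mem[OF \<open>x \<in> cube n\<close>[unfolded cube_def] that] by auto
    then show ?thesis using sum_bounded_above[of "{1..n}" x 1] by simp
  qed
  have "THR n k x = (if k \<le> 0 then -1 else 1)" if x: "x \<in> cube n" for x
  proof -
    have "int (\<Sum>i = 1..n. x i) \<ge> k \<longleftrightarrow> k \<le> 0"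
      using le[OF x] assms by linarith
    then show ?thesis unfolding THR_def by presburger
  qed
  then have "pdt_computes n (Leaf (if k \<le> 0 then -1 else 1)) (THR n k)"
    by (simp add: pdt_computes_def)
  from D_xor_le[OF this] show ?thesis by simp
qed

text \<open>The condition for \<open>s = 0\<close> excludes exactly the \<open>k\<close> for which
  the larger function is constant: there both depths are 0 and the bound would fail.\<close>

theorem theorem14:
  fixes s k :: int and n :: nat
  assumes "n \<ge> 1"
    and "s = 0 \<Longrightarrow> 0 \<le> k \<and> k \<le> int n + 1"
    and "int (D_xor n (THR n k)) \<ge> s"
  shows "int (D_xor (n + 2) (THR (n + 2) (k + 1))) \<ge> s + 1"
proof -
  have "THR (n + 2) (k + 1) \<in> cube (n + 2) \<rightarrow> {-1, 1}" by (auto simp: THR_def)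
  then obtain t where t: "pdt_computes (n + 2) t (THR (n + 2) (k + 1))"
    "pdt_depth t = D_xor (n + 2) (THR (n + 2) (k + 1))"
    by (rule D_xor_attained)
  show ?thesis
  proof (cases t)
    case (Leaf b)
    then have k: "k + 1 \<le> 0 \<or> k + 1 > int (n + 2)"
      using t(1) by (intro THR_const_threshold[of _ _ b]) (simp add: pdt_computes_def)
    then have "D_xor n (THR n k) = 0" by (intro D_xor_THR_const) auto
    \<comment> \<open>Depth 0 forces \<open>s \<le> 0\<close>, and \<open>s = 0\<close> is ruled out
      because here \<open>k < 0\<close> or \<open>k > n + 1\<close>.\<close>
    then have "s < 0" using k assms(2,3) by force
    then show ?thesis by simp
  next
    case (Query S t0 t1)
    then show ?thesis using THR_pdt_strip_root t assms(3) by fastforce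
  qed
qed

end
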